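(* Let $G$ be a group and $H$ a subgroup of $G$. Then the preradical $\operatorname{Tr}_H$ is idempotent; that is, for every $G$-set $X$, $\operatorname{Tr}_H\bigl(\operatorname{Tr}_H(X)\bigr)=\operatorname{Tr}_H(X)$.
   Context: $G/H$ is the set of left cosets of $H$ with the left translation action of $G$. For a (left) $G$-set $X$, the $H$-trace is $\operatorname{Tr}_H(X)=\bigcup\{\operatorname{im}(\alpha)\mid \alpha\colon G/H\to X \text{ a } G\text{-equivariant map}\}$, which is a $G$-subset of $X$ and is regarded as a $G$-set with the restricted action. A preradical on a category is a subfunctor of its identity functor. *)

theory Defs
  imports "HOL-Algebra.Group_Action" "HOL-Algebra.Left_Coset" "HOL-Library.FuncSet"
begin

text \<open>
  A \<open>G\<close>-set is a pair \<open>(E, \<phi>)\<close> of a set and a left action on it. As in the library's locale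
  \<^locale>\<open>group_action\<close>, each \<open>\<phi> g\<close> with \<open>g \<in> carrier G\<close> is extensional on \<open>E\<close>, which is why actions
  are cut off with \<^const>\<open>restrict\<close> below.
\<close>

type_synonym ('a, 'x) Gset = "'x set \<times> ('a \<Rightarrow> 'x \<Rightarrow> 'x)"

definition is_Gset :: "('a, 'm) monoid_scheme \<Rightarrow> ('a, 'x) Gset \<Rightarrow> bool" where
  "is_Gset G X \<longleftrightarrow> group_action G (fst X) (snd X)"

definition equivariant ::
  "('a, 'm) monoid_scheme \<Rightarrow> ('a, 'x) Gset \<Rightarrow> ('a, 'y) Gset \<Rightarrow> ('x \<Rightarrow> 'y) \<Rightarrow> bool" where
  "equivariant G X Y f \<longleftrightarrow>
     f \<in> fst X \<rightarrow> fst Y \<and>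
     (\<forall>g\<in>carrier G. \<forall>x\<in>fst X. f (snd X g x) = snd Y g (f x))"

definition Gsubset :: "('a, 'm) monoid_scheme \<Rightarrow> 'x set \<Rightarrow> ('a, 'x) Gset \<Rightarrow> bool" where
  "Gsubset G S X \<longleftrightarrow> S \<subseteq> fst X \<and> (\<forall>g\<in>carrier G. \<forall>x\<in>S. snd X g x \<in> S)"

definition restrict_Gset :: "('a, 'x) Gset \<Rightarrow> 'x set \<Rightarrow> ('a, 'x) Gset" where
  "restrict_Gset X S = (S, \<lambda>g. restrict (snd X g) S)"

definition coset_Gset :: "('a, 'm) monoid_scheme \<Rightarrow> 'a set \<Rightarrow> ('a, 'a set) Gset" where
  "coset_Gset G H =
     (lcosets\<^bsub>G\<^esub> H, \<lambda>g. \<lambda>C \<in> lcosets\<^bsub>G\<^esub> H. g <#\<^bsub>G\<^esub> C)"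

definition Tr :: "('a, 'm) monoid_scheme \<Rightarrow> 'a set \<Rightarrow> ('a, 'x) Gset \<Rightarrow> ('a, 'x) Gset" where
  "Tr G H X =
     restrict_Gset X (\<Union>{\<alpha> ` fst (coset_Gset G H) |\<alpha>. equivariant G (coset_Gset G H) X \<alpha>})"

text \<open>
  A subfunctor of the identity functor of the category of \<open>G\<close>-sets: on objects it picks a
  \<open>G\<close>-subset with the restricted action, and every morphism restricts to the chosen subsets.
  The underlying sets of all objects are taken in one type \<open>'x\<close>.
\<close>

definition preradical ::
  "('a, 'm) monoid_scheme \<Rightarrow> (('a, 'x) Gset \<Rightarrow> ('a, 'x) Gset) \<Rightarrow> bool" where
  "preradical G T \<longleftrightarrow>
     (\<forall>X. is_Gset G X \<longrightarrow> Gsubset G (fst (T X)) X \<and> T X = restrict_Gset X (fst (T X))) \<and>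
     (\<forall>X Y f. is_Gset G X \<and> is_Gset G Y \<and> equivariant G X Y f \<longrightarrow>
        f ` fst (T X) \<subseteq> fst (T Y))"

text \<open>For the trace, restricting morphisms also works between \<open>G\<close>-sets over different types.\<close>

lemma Tr_equivariant_image:
  fixes X :: "('a, 'x) Gset" and Y :: "('a, 'y) Gset"
  assumes "equivariant G X Y f"
  shows "f ` fst (Tr G H X) \<subseteq> fst (Tr G H Y)"
proof
  fix y assume "y \<in> f ` fst (Tr G H X)"
  then obtain \<alpha> where \<alpha>: "equivariant G (coset_Gset G H) X \<alpha>"
    and y: "y \<in> (f \<circ> \<alpha>) ` fst (coset_Gset G H)"
    unfolding Tr_def restrict_Gset_def fst_conv image_comp[symmetric] by blast
  have "equivariant G (coset_Gset G H) Y (f \<circ> \<alpha>)"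
    using assms \<alpha> unfolding equivariant_def Pi_iff comp_def by metis
  with y show "y \<in> fst (Tr G H Y)"
    unfolding Tr_def restrict_Gset_def fst_conv by blast
qed

end

theory Submission
  imports Defs
begin

text \<open>An equivariant map \<alpha> from G/H to X has its image inside the trace, so it
  corestricts to an equivariant map into the trace with the same image
  (\<open>equivariant_Tr\<close>). Hence taking the trace again loses no point, and it cannot add
  any (\<open>fst_Tr_Tr\<close>). The actions agree because restricting twice to one set is
  restricting once. The preradical property holds because images of equivariant maps are stable
  under G (\<open>Gsubset_Tr\<close>) and a map f sends the image of \<alpha> to that of f \<circ>
  \<alpha>.\<close>

lemma (in group) l_coset_LCOSETS:
  assumes "subgroup H G" "g \<in> carrier G" "C \<in> lcosets H"
  shows "g <# C \<in> lcosets H"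
proof -
  obtain a where a: "a \<in> carrier G" "C = a <# H"
    using assms(3) unfolding LCOSETS_def by blast
  have "g <# C = (g \<otimes> a) <# H"
    using lcos_m_assoc[OF subgroup.subset[OF assms(1)] assms(2) a(1)] a(2) by simp
  moreover have "g \<otimes> a \<in> carrier G" using assms(2) a(1) by simp
  ultimately show ?thesis unfolding LCOSETS_def by blast
qed

lemma fst_Tr:
  "fst (Tr G H X) =
    \<Union>{\<alpha> ` fst (coset_Gset G H) |\<alpha>. equivariant G (coset_Gset G H) X \<alpha>}"
  by (simp add: Tr_def restrict_Gset_def)

lemma Tr_eq_restrict_Gset: "Tr G H X = restrict_Gset X (fst (Tr G H X))"
  by (simp add: Tr_def restrict_Gset_def)

lemma Gsubset_Tr:
  assumes "group G" "subgroup H G"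
  shows "Gsubset G (fst (Tr G H X)) X"
  unfolding Gsubset_def
proof (intro conjI ballI)
  show "fst (Tr G H X) \<subseteq> fst X"
    unfolding fst_Tr equivariant_def by blast
next
  fix g x assume g: "g \<in> carrier G" and "x \<in> fst (Tr G H X)"
  then obtain \<alpha> C where \<alpha>: "equivariant G (coset_Gset G H) X \<alpha>"
    and C: "C \<in> fst (coset_Gset G H)" and x: "x = \<alpha> C"
    unfolding fst_Tr by blast
  \<comment> \<open>The translate of \<open>C\<close> by \<open>g\<close> is the coset that \<alpha>
    sends to the translate of \<open>x\<close>, so the same \<alpha> witnesses membership.\<close>
  have "snd (coset_Gset G H) g C \<in> fst (coset_Gset G H)"
    using C group.l_coset_LCOSETS[OF assms g] by (simp add: coset_Gset_def)
  moreover have "snd X g x = \<alpha> (snd (coset_Gset G H) g C)"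
    using \<alpha> g C x unfolding equivariant_def by metis
  ultimately show "snd X g x \<in> fst (Tr G H X)"
    using \<alpha> unfolding fst_Tr by blast
qed

lemma preradical_Tr:
  fixes G :: "('a, 'm) monoid_scheme"
  assumes "group G" "subgroup H G"
  shows "preradical G (Tr G H :: ('a, 'x) Gset \<Rightarrow> ('a, 'x) Gset)"
  unfolding preradical_def
proof (intro conjI allI impI)
  fix X :: "('a, 'x) Gset"
  show "Gsubset G (fst (Tr G H X)) X"
    by (rule Gsubset_Tr[OF assms])
  show "Tr G H X = restrict_Gset X (fst (Tr G H X))"
    by (rule Tr_eq_restrict_Gset)
next
  fix X Y :: "('a, 'x) Gset" and f
  assume "is_Gset G X \<and> is_Gset G Y \<and> equivariant G X Y f"
  then show "f ` fst (Tr G H X) \<subseteq> fst (Tr G H Y)"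
    by (intro Tr_equivariant_image) simp
qed

text \<open>The corestriction of \<alpha> is the same function: only the codomain and its action
  change.\<close>

lemma equivariant_Tr:
  assumes "equivariant G (coset_Gset G H) X \<alpha>"
  shows "equivariant G (coset_Gset G H) (Tr G H X) \<alpha>"
proof -
  have im: "\<alpha> C \<in> fst (Tr G H X)" if "C \<in> fst (coset_Gset G H)" for C
    using that assms unfolding fst_Tr by blast
  \<comment> \<open>The action on the trace is \<open>undefined\<close> outside it;
    \<open>im\<close> excludes that case.\<close>
  moreover have "snd (Tr G H X) g (\<alpha> C) = snd X g (\<alpha> C)"
    if "C \<in> fst (coset_Gset G H)" for g C
    using im[OF that] by (simp add: Tr_def restrict_Gset_def)
  ultimately show ?thesis
    using assms unfolding equivariant_def by auto
qed

text \<open>One inclusion holds since maps into the trace take values there, the other by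
  corestriction.\<close>

lemma fst_Tr_Tr: "fst (Tr G H (Tr G H X)) = fst (Tr G H X)"
proof
  show "fst (Tr G H (Tr G H X)) \<subseteq> fst (Tr G H X)"
    unfolding fst_Tr[of G H "Tr G H X"] equivariant_def by blast
  show "fst (Tr G H X) \<subseteq> fst (Tr G H (Tr G H X))"
    unfolding fst_Tr[of G H X] fst_Tr[of G H "Tr G H X"] using equivariant_Tr by blast
qed

lemma restrict_Gset_restrict_Gset:
  "restrict_Gset (restrict_Gset X S) S = restrict_Gset X S"
  by (simp add: restrict_Gset_def)

text \<open>Equal carriers do not suffice, as a G-set also carries its action. Both actions are cut
  off to the same carrier, which determines them from that of \<open>X\<close>.\<close>

lemma Tr_Tr: "Tr G H (Tr G H X) = Tr G H X"
proof -
  let ?S = "fst (Tr G H X)"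
  have "Tr G H (Tr G H X) = restrict_Gset (Tr G H X) ?S"
    using Tr_eq_restrict_Gset[of G H "Tr G H X"] unfolding fst_Tr_Tr .
  also have "\<dots> = restrict_Gset (restrict_Gset X ?S) ?S"
    \<comment> \<open>Only the first argument is expanded: the right side of the equation contains
      its left side, so rewriting with it would not stop.\<close>
    by (rule arg_cong[OF Tr_eq_restrict_Gset])
  also have "\<dots> = Tr G H X"
    unfolding restrict_Gset_restrict_Gset by (rule Tr_eq_restrict_Gset[symmetric])
  finally show ?thesis .
qed

theorem proposition16:
  fixes G :: "('a, 'm) monoid_scheme" and H :: "'a set"
  assumes "group G" and "subgroup H G"
  shows "preradical G (Tr G H :: ('a, 'x) Gset \<Rightarrow> ('a, 'x) Gset) \<and>
    (\<forall>X :: ('a, 'x) Gset. is_Gset G X \<longrightarrow> Tr G H (Tr G H X) = Tr G H X)"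
  by (intro conjI allI impI preradical_Tr[OF assms] Tr_Tr)

end
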